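(* (Bott's formulae) Let $z_0$ be a fixed point of the Hamiltonian diffeomorphism $\phi=\phi_{k-1}\circ\dots\circ\phi_0$ of $\mathbb{R}^{2d}$ and let $\boldsymbol z=(z_0,\dots,z_{k-1})$ be the corresponding critical point of the generating family $F_1$. For all integers $p\geq1$ and all $\theta\in S^1$, we have $$\mathrm{nul}_\theta(\boldsymbol z^p)=\sum_{\mu\in\sqrt[p]{\theta}}\mathrm{nul}_\mu(\boldsymbol z),\qquad \mathrm{ind}_\theta(\boldsymbol z^p)=\sum_{\mu\in\sqrt[p]{\theta}}\mathrm{ind}_\mu(\boldsymbol z),\qquad \mathrm{coind}_\theta(\boldsymbol z^p)=\sum_{\mu\in\sqrt[p]{\theta}}\mathrm{coind}_\mu(\boldsymbol z),$$ where $\sqrt[p]{\theta}=\{\mu\in\mathbb{C}\mid\mu^p=\theta\}$.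
   Context: Points of $\mathbb{R}^{2d}$ are written $z=(x,y)$ with $x,y\in\mathbb{R}^d$; the symplectic form is $dx\wedge dy$. $S^1\subset\mathbb{C}$ is the unit circle. A smooth function $f:\mathbb{R}^{2d}\to\mathbb{R}$ is a generating function for a Hamiltonian diffeomorphism $\psi$ of $\mathbb{R}^{2d}$ if $\psi(x_0,y_0)=(x_1,y_1)$ if and only if $x_1-x_0=-\partial_yf(x_1,y_0)$ and $y_1-y_0=\partial_xf(x_1,y_0)$. Let $\phi=\phi_{k-1}\circ\dots\circ\phi_0$ be a Hamiltonian diffeomorphism of $\mathbb{R}^{2d}$, each $\phi_j$ being a Hamiltonian diffeomorphism with generating function $f_j$. For $p\ge1$, the generating family of $\phi^p$ is $F_p:\mathbb{R}^{2dkp}\to\mathbb{R}$, $$F_p(z_0,\dots,z_{kp-1})=\sum_{j\in\mathbb{Z}_{kp}}\big(\langle y_j,x_{j+1}-x_j\rangle+f_{j\bmod k}(x_{j+1},y_j)\big).$$ A fixed point $z_0$ of $\phi$ gives the critical point $\boldsymbol z=(z_0,\dots,z_{k-1})$ of $F_1$, where $z_j=\phi_{j-1}(z_{j-1})$, and the critical point $\boldsymbol z^p=(\boldsymbol z,\dots,\boldsymbol z)$ of $F_p$. For $j\in\mathbb{Z}_k$ set $A_j=\partial_{xx}f_j(x_{j+1},y_j)$, $B_j=\partial_{xy}f_j(x_{j+1},y_j)$, $C_j=\partial_{yy}f_j(x_{j+1},y_j)$ (with the convention that $\langle B_jX,Y\rangle$ is the mixed second derivative in the directions $X$ for $x$ and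 $Y$ for $y$), extended $k$-periodically in $j$. Standing assumption: the norms of $A_j,B_j,C_j$ are bounded by some $\epsilon<1$. For $\theta\in S^1$, the $\theta$-Hessian $H_{p,\theta}$ of $F_p$ at $\boldsymbol z^p$ is the Hermitian endomorphism of $\mathbb{C}^{2dkp}$ sending $(Z_0,\dots,Z_{kp-1})$, $Z_j=(X_j,Y_j)\in\mathbb{C}^d\times\mathbb{C}^d$, to $(Z'_0,\dots,Z'_{kp-1})$, $Z'_j=(X'_j,Y'_j)$, where, after extending $(Z_j)$ to all $j\in\mathbb{Z}$ by $Z_{j+kp}=\theta Z_j$, $$X'_j=Y_{j-1}-Y_j+A_{j-1}X_j+B_{j-1}^TY_{j-1},\qquad Y'_j=X_{j+1}-X_j+B_jX_{j+1}+C_jY_j .$$ The Bott indices $\mathrm{ind}_\theta(\boldsymbol z^p)$, $\mathrm{coind}_\theta(\boldsymbol z^p)$, $\mathrm{nul}_\theta(\boldsymbol z^p)$ are respectively the number of negative eigenvalues, the number of positive eigenvalues (both counted with multiplicity), and the complex dimension of the kernel of $H_{p,\theta}$. For $p=1$ one writes $\boldsymbol z$ for $\boldsymbol z^1$. *)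

theory Defs
  imports "HOL-Analysis.Analysis" "HOL-Library.Function_Algebras"
begin

section \<open>Smooth functions and Hamiltonian diffeomorphisms\<close>

type_synonym 'd phase = "(real^'d) \<times> (real^'d)"
type_synonym 'd cphase = "(complex^'d) \<times> (complex^'d)"

text \<open>\<open>C_diff n g\<close>: \<open>g\<close> is \<open>n\<close> times differentiable, with continuous derivatives of order \<open>n\<close>.\<close>

fun C_diff :: "nat \<Rightarrow> ('a::real_normed_vector \<Rightarrow> 'b::real_normed_vector) \<Rightarrow> bool" where
  "C_diff 0 g \<longleftrightarrow> continuous_on UNIV g"
| "C_diff (Suc n) g \<longleftrightarrow>
     (\<forall>x. g differentiable (at x)) \<and> (\<forall>v. C_diff n (\<lambda>x. frechet_derivative g (at x) v))"

definition smooth :: "('a::real_normed_vector \<Rightarrow> 'b::real_normed_vector) \<Rightarrow> bool" where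
  "smooth g \<longleftrightarrow> (\<forall>n. C_diff n g)"

definition diffeo :: "('a::real_normed_vector \<Rightarrow> 'a) \<Rightarrow> bool" where
  "diffeo \<psi> \<longleftrightarrow> bij \<psi> \<and> smooth \<psi> \<and> smooth (inv \<psi>)"

definition grad_x :: "('d::finite phase \<Rightarrow> real) \<Rightarrow> 'd phase \<Rightarrow> real^'d" where
  "grad_x f z = (\<chi> a. frechet_derivative f (at z) (axis a 1, 0))"

definition grad_y :: "('d::finite phase \<Rightarrow> real) \<Rightarrow> 'd phase \<Rightarrow> real^'d" where
  "grad_y f z = (\<chi> a. frechet_derivative f (at z) (0, axis a 1))"

text \<open>The sign of the Hamiltonian vector field for \<open>dx \<and> dy\<close> is immaterial below, since \<open>H\<close>
  may be replaced by \<open>- H\<close>; it is chosen to agree with the generating function equations.\<close>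

definition ham_field :: "(real \<times> 'd::finite phase \<Rightarrow> real) \<Rightarrow> real \<Rightarrow> 'd phase \<Rightarrow> 'd phase" where
  "ham_field H t z = (- grad_y (\<lambda>w. H (t, w)) z, grad_x (\<lambda>w. H (t, w)) z)"

text \<open>Time-one maps of Hamiltonian isotopies. The Hamiltonian is time-dependent and not required
  to have compact support. Joint smoothness of the isotopy in \<open>(t, z)\<close> is automatic from the
  smooth dependence of solutions of differential equations on their initial data.\<close>

definition hamiltonian_diffeo :: "('d::finite phase \<Rightarrow> 'd phase) \<Rightarrow> bool" where
  "hamiltonian_diffeo \<psi> \<longleftrightarrow>
     (\<exists>H \<Phi>. smooth H \<and> (\<forall>t\<in>{0..1}. diffeo (\<Phi> t)) \<and> \<Phi> 0 = id \<and> \<Phi> 1 = \<psi> \<and>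
        (\<forall>z. \<forall>t\<in>{0..1}.
          ((\<lambda>s. \<Phi> s z) has_vector_derivative ham_field H t (\<Phi> t z)) (at t within {0..1})))"

definition generating_function ::
  "('d::finite phase \<Rightarrow> real) \<Rightarrow> ('d phase \<Rightarrow> 'd phase) \<Rightarrow> bool" where
  "generating_function f \<psi> \<longleftrightarrow> smooth f \<and>
     (\<forall>x0 y0 x1 y1. \<psi> (x0, y0) = (x1, y1) \<longleftrightarrow>
        x1 - x0 = - grad_y f (x1, y0) \<and> y1 - y0 = grad_x f (x1, y0))"

fun comp_upto :: "(nat \<Rightarrow> 'a \<Rightarrow> 'a) \<Rightarrow> nat \<Rightarrow> 'a \<Rightarrow> 'a" where
  "comp_upto \<phi> 0 = id"
| "comp_upto \<phi> (Suc n) = \<phi> n \<circ> comp_upto \<phi> n"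

section \<open>Second derivatives of the generating functions\<close>

text \<open>\<open>hess_xy\<close> is the matrix \<open>B\<close> for which \<open>inner (B *v X) Y\<close> is the mixed second
  derivative in the directions \<open>X\<close> for \<open>x\<close> and \<open>Y\<close> for \<open>y\<close>.\<close>

definition hess_xx :: "('d::finite phase \<Rightarrow> real) \<Rightarrow> 'd phase \<Rightarrow> real^'d^'d" where
  "hess_xx f z = matrix (\<lambda>X. frechet_derivative (grad_x f) (at z) (X, 0))"

definition hess_xy :: "('d::finite phase \<Rightarrow> real) \<Rightarrow> 'd phase \<Rightarrow> real^'d^'d" where
  "hess_xy f z = matrix (\<lambda>X. frechet_derivative (grad_y f) (at z) (X, 0))"

definition hess_yy :: "('d::finite phase \<Rightarrow> real) \<Rightarrow> 'd phase \<Rightarrow> real^'d^'d" where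
  "hess_yy f z = matrix (\<lambda>Y. frechet_derivative (grad_y f) (at z) (0, Y))"

text \<open>The point \<open>(x_{j+1}, y_j)\<close>, for a \<open>k\<close>-tuple \<open>z\<close> (the values \<open>z 0, \<dots>, z (k - 1)\<close>) extended
  \<open>k\<close>-periodically to all integers.\<close>

definition mixed_pt :: "nat \<Rightarrow> (nat \<Rightarrow> 'd::finite phase) \<Rightarrow> int \<Rightarrow> 'd phase" where
  "mixed_pt k z j = (fst (z (nat ((j + 1) mod int k))), snd (z (nat (j mod int k))))"

definition matA :: "(nat \<Rightarrow> 'd::finite phase \<Rightarrow> real) \<Rightarrow> nat \<Rightarrow> (nat \<Rightarrow> 'd phase) \<Rightarrow> int \<Rightarrow> real^'d^'d" where
  "matA f k z j = hess_xx (f (nat (j mod int k))) (mixed_pt k z j)"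

definition matB :: "(nat \<Rightarrow> 'd::finite phase \<Rightarrow> real) \<Rightarrow> nat \<Rightarrow> (nat \<Rightarrow> 'd phase) \<Rightarrow> int \<Rightarrow> real^'d^'d" where
  "matB f k z j = hess_xy (f (nat (j mod int k))) (mixed_pt k z j)"

definition matC :: "(nat \<Rightarrow> 'd::finite phase \<Rightarrow> real) \<Rightarrow> nat \<Rightarrow> (nat \<Rightarrow> 'd phase) \<Rightarrow> int \<Rightarrow> real^'d^'d" where
  "matC f k z j = hess_yy (f (nat (j mod int k))) (mixed_pt k z j)"

section \<open>The \<open>\<theta>\<close>-Hessian and the Bott indices\<close>

text \<open>A tuple \<open>(Z_0, \<dots>, Z_{N-1})\<close> of points of \<open>\<complex>\<^sup>d \<times> \<complex>\<^sup>d\<close> is a function on \<open>nat\<close> vanishing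
  from \<open>N\<close> on; thus \<open>ctuples N\<close> is the space \<open>\<complex>\<close> to the power \<open>2 d N\<close>.\<close>

definition ctuples :: "nat \<Rightarrow> (nat \<Rightarrow> 'd::finite cphase) set" where
  "ctuples N = {Z. \<forall>j\<ge>N. Z j = 0}"

definition cscale :: "complex \<Rightarrow> 'd::finite cphase \<Rightarrow> 'd cphase" where
  "cscale c W = (c *s fst W, c *s snd W)"

definition tscale :: "complex \<Rightarrow> (nat \<Rightarrow> 'd::finite cphase) \<Rightarrow> (nat \<Rightarrow> 'd cphase)" where
  "tscale c Z = (\<lambda>j. cscale c (Z j))"

interpretation ctup: vector_space "tscale :: complex \<Rightarrow> (nat \<Rightarrow> 'd::finite cphase) \<Rightarrow> _"
  by unfold_locales
    (auto simp: tscale_def cscale_def fun_eq_iff vector_add_ldistrib vector_sadd_rdistrib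
      prod_eq_iff)

text \<open>The extension of a tuple to all integers determined by \<open>Z_{j+N} = \<theta> Z_j\<close>.\<close>

definition quasi_ext :: "nat \<Rightarrow> complex \<Rightarrow> (nat \<Rightarrow> 'd::finite cphase) \<Rightarrow> int \<Rightarrow> 'd cphase" where
  "quasi_ext N \<theta> Z j = cscale (\<theta> powi (j div int N)) (Z (nat (j mod int N)))"

abbreviation complexify :: "real^'n^'m \<Rightarrow> complex^'n^'m" where
  "complexify \<equiv> map_matrix complex_of_real"

definition theta_hessian ::
  "(nat \<Rightarrow> 'd::finite phase \<Rightarrow> real) \<Rightarrow> nat \<Rightarrow> (nat \<Rightarrow> 'd phase) \<Rightarrow> nat \<Rightarrow> complex \<Rightarrow>
   (nat \<Rightarrow> 'd cphase) \<Rightarrow> (nat \<Rightarrow> 'd cphase)" where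
  "theta_hessian f k z p \<theta> Z = (\<lambda>i. if i < k * p then
     (let j = int i;
          X = (\<lambda>l. fst (quasi_ext (k * p) \<theta> Z l));
          Y = (\<lambda>l. snd (quasi_ext (k * p) \<theta> Z l));
          A = (\<lambda>l. complexify (matA f k z l));
          B = (\<lambda>l. complexify (matB f k z l));
          C = (\<lambda>l. complexify (matC f k z l))
      in (Y (j - 1) - Y j + A (j - 1) *v X j + transpose (B (j - 1)) *v Y (j - 1),
          X (j + 1) - X j + B j *v X (j + 1) + C j *v Y j))
     else 0)"

definition theta_eigenspace ::
  "(nat \<Rightarrow> 'd::finite phase \<Rightarrow> real) \<Rightarrow> nat \<Rightarrow> (nat \<Rightarrow> 'd phase) \<Rightarrow> nat \<Rightarrow> complex \<Rightarrow> real \<Rightarrow>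
   (nat \<Rightarrow> 'd cphase) set" where
  "theta_eigenspace f k z p \<theta> \<nu> =
     {Z \<in> ctuples (k * p). theta_hessian f k z p \<theta> Z = tscale (complex_of_real \<nu>) Z}"

definition theta_eigenvalues ::
  "(nat \<Rightarrow> 'd::finite phase \<Rightarrow> real) \<Rightarrow> nat \<Rightarrow> (nat \<Rightarrow> 'd phase) \<Rightarrow> nat \<Rightarrow> complex \<Rightarrow> real set" where
  "theta_eigenvalues f k z p \<theta> = {\<nu>. \<exists>Z \<in> theta_eigenspace f k z p \<theta> \<nu>. Z \<noteq> 0}"

text \<open>For \<open>\<theta>\<close> on the unit circle the \<open>\<theta>\<close>-Hessian is Hermitian: its eigenvalues are real, and the
  multiplicity of an eigenvalue is the complex dimension of its eigenspace.\<close>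

definition bott_ind ::
  "(nat \<Rightarrow> 'd::finite phase \<Rightarrow> real) \<Rightarrow> nat \<Rightarrow> (nat \<Rightarrow> 'd phase) \<Rightarrow> nat \<Rightarrow> complex \<Rightarrow> nat" where
  "bott_ind f k z p \<theta> =
     (\<Sum>\<nu> \<in> {\<nu> \<in> theta_eigenvalues f k z p \<theta>. \<nu> < 0}. ctup.dim (theta_eigenspace f k z p \<theta> \<nu>))"

definition bott_coind ::
  "(nat \<Rightarrow> 'd::finite phase \<Rightarrow> real) \<Rightarrow> nat \<Rightarrow> (nat \<Rightarrow> 'd phase) \<Rightarrow> nat \<Rightarrow> complex \<Rightarrow> nat" where
  "bott_coind f k z p \<theta> =
     (\<Sum>\<nu> \<in> {\<nu> \<in> theta_eigenvalues f k z p \<theta>. \<nu> > 0}. ctup.dim (theta_eigenspace f k z p \<theta> \<nu>))"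

definition bott_nul ::
  "(nat \<Rightarrow> 'd::finite phase \<Rightarrow> real) \<Rightarrow> nat \<Rightarrow> (nat \<Rightarrow> 'd phase) \<Rightarrow> nat \<Rightarrow> complex \<Rightarrow> nat" where
  "bott_nul f k z p \<theta> = ctup.dim {Z \<in> ctuples (k * p). theta_hessian f k z p \<theta> Z = 0}"

end

theory Submission
  imports Defs
begin

text \<open>Identify \<open>p k\<close>-tuples with bi-infinite sequences satisfying \<open>Z\<^bsub>j+kp\<^esub> = \<theta> Z\<^bsub>j\<^esub>\<close>. The \<open>\<theta>\<close>-Hessians
  for all \<open>p\<close> and \<open>\<theta>\<close> are then restrictions of one difference operator, which commutes with the
  shift \<open>T\<close> by \<open>k\<close> because its coefficients are \<open>k\<close>-periodic. On an eigenspace of the \<open>\<theta>\<close>-Hessian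
  of order \<open>p\<close> one has \<open>T\<^sup>p = \<theta>\<close>, so it is the direct sum of the eigenspaces of \<open>T\<close> for the
  \<open>p\<close>-th roots \<open>\<mu>\<close> of \<open>\<theta>\<close>, and these are the eigenspaces of the \<open>\<mu>\<close>-Hessians of order one with
  the same eigenvalue.\<close>

section \<open>Eigenspaces of linear endomorphisms\<close>

text \<open>A basis of \<open>S\<close> is carried to a basis of the image. Injectivity is asked on
  the span because independence concerns linear combinations, which may leave
  \<open>S\<close>.\<close>

lemma (in vector_space_pair) dim_image_eq_inj:
  assumes lf: "Vector_Spaces.linear s1 s2 f" and inj: "inj_on f (vs1.span S)"
  shows "vs2.dim (f ` S) = vs1.dim S"
proof -
  obtain B where B: "B \<subseteq> S" "vs1.independent B" "S \<subseteq> vs1.span B" "card B = vs1.dim S"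
    using vs1.basis_exists by blast
  have span: "vs1.span B \<subseteq> vs1.span S"
    using B(1) by (rule vs1.span_mono)
  have "inj_on f B"
    using inj span vs1.span_superset by (meson inj_on_subset order_trans)
  then have "card (f ` B) = vs1.dim S"
    using B(4) by (simp add: card_image)
  moreover have "vs2.independent (f ` B)"
    using lf B(2) inj_on_subset[OF inj span] by (rule linear_independent_injective_image)
  ultimately show ?thesis
    using vs2.dim_unique[of "f ` B" "f ` S"] linear_spans_image[OF lf B(3)] B(1) by blast
qed

context vector_space
begin

text \<open>Each index is itself the eigenvalue, so distinct indices mean distinct eigenvalues.
  Applying \<open>T - a\<close> to the sum kills the term at \<open>a\<close> and multiplies every
  other term by \<open>i - a\<close>, which is nonzero; induction then removes the others.\<close>

lemma eigenvectors_sum_eq_0: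
  assumes T: "Vector_Spaces.linear scale scale T" and "finite I"
    and "\<And>i. i \<in> I \<Longrightarrow> T (u i) = scale i (u i)"
    and "sum u I = 0" and "i \<in> I"
  shows "u i = 0"
  using assms(2-)
proof (induction I arbitrary: u i rule: finite_induct)
  case empty
  then show ?case by simp
next
  case (insert a I)
  interpret T: Vector_Spaces.linear scale scale T by fact
  have "(\<Sum>i\<in>insert a I. scale (i - a) (u i))
      = (\<Sum>i\<in>insert a I. T (u i)) - scale a (\<Sum>i\<in>insert a I. u i)"
    by (simp add: scale_left_diff_distrib sum_subtractf scale_sum_right insert.prems(1)
        del: sum.insert)
  also have "\<dots> = 0"
    using insert.prems(2) by (simp add: T.sum[symmetric] del: sum.insert)
  finally have "(\<Sum>i\<in>I. scale (i - a) (u i)) = 0"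
    using insert.hyps by simp
  then have "scale (i - a) (u i) = 0" if "i \<in> I" for i
    using insert.IH[of "\<lambda>i. scale (i - a) (u i)" i] that insert.prems(1)
    by (simp add: T.scale scale_left_commute)
  then have I: "u i = 0" if "i \<in> I" for i
    using that insert.hyps(2) by (metis eq_iff_diff_eq_0 scale_eq_0_iff)
  then have "u a = 0"
    using insert.prems(2) insert.hyps by simp
  then show ?case
    using I insert.prems(3) by blast
qed

text \<open>A vanishing combination is grouped by eigenvalue. Each group satisfies the eigenvector
  equation, hence vanishes by \<open>eigenvectors_sum_eq_0\<close>, and independence of the single
  \<open>B i\<close> finishes.\<close>

lemma independent_Union_eigenvectors:
  assumes T: "Vector_Spaces.linear scale scale T"
    and indep: "\<And>i. i \<in> I \<Longrightarrow> independent (B i)"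
    and eig: "\<And>i v. i \<in> I \<Longrightarrow> v \<in> B i \<Longrightarrow> T v = scale i v"
  shows "independent (\<Union>i\<in>I. B i)" and "disjoint_family_on B I"
proof -
  interpret T: Vector_Spaces.linear scale scale T by fact
  have nz: "v \<noteq> 0" if "i \<in> I" "v \<in> B i" for i v
    using that indep dependent_zero by blast
  then have uniq: "i = j" if "i \<in> I" "j \<in> I" "v \<in> B i" "v \<in> B j" for i j v
    using that eig by (metis scale_right_imp_eq)
  then show "disjoint_family_on B I"
    unfolding disjoint_family_on_def by blast
  show "independent (\<Union>i\<in>I. B i)"
    unfolding independent_explicit_finite_subsets
  proof (intro allI impI ballI)
    fix S c v
    assume S: "S \<subseteq> (\<Union>i\<in>I. B i)" "finite S" and sum: "(\<Sum>v\<in>S. scale (c v) v) = 0"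
      and v: "v \<in> S"
    \<comment> \<open>\<open>e v\<close> is the eigenvalue of \<open>v\<close>; the grouping is by
      the fibres of \<open>e\<close>.\<close>
    obtain e where e: "\<And>v. v \<in> S \<Longrightarrow> e v \<in> I \<and> v \<in> B (e v)"
      using S(1) by (metis UN_E subsetD)
    have eigS: "T v = scale (e v) v" if "v \<in> S" for v
      using e[OF that] eig by blast
    define u where "u i = (\<Sum>v | v \<in> S \<and> e v = i. scale (c v) v)" for i
    have "sum u (e ` S) = 0"
      unfolding u_def sum by (subst sum.group) (use S(2) sum in auto)
    moreover have "T (u i) = scale i (u i)" if "i \<in> e ` S" for i
      unfolding u_def T.sum scale_sum_right
      by (rule sum.cong) (auto simp: T.scale eigS scale_left_commute)
    ultimately have "u (e v) = 0"
      using eigenvectors_sum_eq_0[OF T] S(2) v by blast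
    then show "c v = 0"
      unfolding u_def
      by (rule independentD[OF indep, of "e v", rotated 3]) (use S(2) v in \<open>auto dest: e\<close>)
  qed
qed

text \<open>One eigenvector chosen for each eigenvalue gives an independent family inside a finitely
  spanned space, and the choice is injective since an eigenvector determines its eigenvalue.\<close>

lemma finite_eigenvalues:
  assumes T: "Vector_Spaces.linear scale scale T" and "finite F" and V: "V \<subseteq> span F"
  shows "finite {i. \<exists>v\<in>V. v \<noteq> 0 \<and> T v = scale i v}" (is "finite ?I")
proof -
  have "\<forall>i\<in>?I. \<exists>v. v \<in> V \<and> v \<noteq> 0 \<and> T v = scale i v"
    by blast
  then obtain v where v: "\<forall>i\<in>?I. v i \<in> V \<and> v i \<noteq> 0 \<and> T (v i) = scale i (v i)"
    by (rule bchoice[THEN exE])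
  have "independent (\<Union>i\<in>?I. {v i})"
    by (rule independent_Union_eigenvectors[OF T]) (use v in auto)
  then have "independent (v ` ?I)"
    unfolding UNION_singleton_eq_range .
  moreover have "v ` ?I \<subseteq> span F"
    using v V by blast
  ultimately have "finite (v ` ?I)"
    using independent_span_bound[OF \<open>finite F\<close>] by simp
  moreover have "inj_on v ?I"
  proof (rule inj_onI)
    fix i j assume i: "i \<in> ?I" and j: "j \<in> ?I" and eq: "v i = v j"
    have "scale i (v i) = scale j (v i)"
      using bspec[OF v i] bspec[OF v j] unfolding eq by (elim conjE) simp
    then show "i = j"
      using bspec[OF v i] by (elim conjE) (rule scale_right_imp_eq)
  qed
  ultimately show ?thesis
    by (rule finite_imageD)
qed

text \<open>Bases of the \<open>E i\<close> are disjoint and jointly independent, and the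
  decomposition hypothesis makes their union span \<open>V\<close>.\<close>

lemma dim_sum_eigenspaces:
  assumes T: "Vector_Spaces.linear scale scale T" and "finite I"
    and E: "\<And>i v. i \<in> I \<Longrightarrow> v \<in> E i \<Longrightarrow> v \<in> V \<and> T v = scale i v"
    and sum: "\<And>w. w \<in> V \<Longrightarrow> \<exists>u. (\<forall>i\<in>I. u i \<in> E i) \<and> w = sum u I"
    and "finite F" and V: "V \<subseteq> span F"
  shows "dim V = (\<Sum>i\<in>I. dim (E i))"
proof -
  have "\<exists>B. B \<subseteq> E i \<and> independent B \<and> E i \<subseteq> span B \<and> card B = dim (E i)" for i
    using basis_exists[of "E i"] by metis
  then obtain B where B: "\<And>i. B i \<subseteq> E i" "\<And>i. independent (B i)" "\<And>i. E i \<subseteq> span (B i)"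
      "\<And>i. card (B i) = dim (E i)"
    by metis
  have eig: "T v = scale i v" if "i \<in> I" "v \<in> B i" for i v
    using that B(1) E by blast
  note indep = independent_Union_eigenvectors[OF T B(2) eig]
  have sub: "(\<Union>i\<in>I. B i) \<subseteq> V"
    using B(1) E by blast
  \<comment> \<open>Finiteness is what lets the cardinality of the disjoint union be added
    up.\<close>
  then have "finite (\<Union>i\<in>I. B i)"
    using independent_span_bound[OF \<open>finite F\<close>] indep(1) V by (meson order_trans)
  then have "card (\<Union>i\<in>I. B i) = (\<Sum>i\<in>I. dim (E i))"
    using indep(2) \<open>finite I\<close>
    by (subst card_UN_disjoint') (auto simp: B(4) intro: finite_subset)
  moreover have "V \<subseteq> span (\<Union>i\<in>I. B i)"
  proof
    fix w assume "w \<in> V"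
    then obtain u where u: "\<forall>i\<in>I. u i \<in> E i" "w = sum u I"
      using sum by blast
    have "u i \<in> span (\<Union>i\<in>I. B i)" if "i \<in> I" for i
      using u(1) that B(3) span_mono[of "B i" "\<Union>i\<in>I. B i"] by blast
    then show "w \<in> span (\<Union>i\<in>I. B i)"
      unfolding u(2) by (rule span_sum)
  qed
  ultimately show ?thesis
    using dim_unique[OF sub _ indep(1)] by blast
qed

end

section \<open>Fourier decomposition over the \<open>p\<close>-th roots of
  \<open>\<theta>\<close>\<close>

text \<open>Multiplication by a primitive \<open>p\<close>-th root of unity permutes the roots of
  \<open>\<theta>\<close> and multiplies the sum by a factor different from 1.\<close>

lemma sum_inverse_powers_nth_roots:
  assumes "\<theta> \<noteq> 0" "0 < r" "r < p"
  shows "(\<Sum>\<mu> | \<mu> ^ p = \<theta>. inverse \<mu> ^ r) = (0::complex)"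
proof -
  define \<omega> where "\<omega> = cis (2 * pi / real p)"
  have "p > 0"
    using assms by simp
  then have \<omega>: "\<omega> ^ p = 1" "\<omega> \<noteq> 0"
    by (auto simp: \<omega>_def Complex.DeMoivre)
  \<comment> \<open>The enumeration of the \<open>p\<close>-th roots of unity is injective below
    \<open>p\<close>, which separates \<open>r\<close> from \<open>0\<close>.\<close>
  have "\<omega> ^ r \<noteq> \<omega> ^ 0"
    using assms inj_onD[OF bij_betw_imp_inj_on[OF Complex.bij_betw_roots_unity[of p]], of r 0]
    by (auto simp: \<omega>_def Complex.DeMoivre mult.commute)
  then have \<omega>r: "inverse \<omega> ^ r \<noteq> 1"
    by (simp add: power_inverse)
  have "bij_betw (\<lambda>\<mu>. \<omega> * \<mu>) {\<mu>. \<mu> ^ p = \<theta>} {\<mu>. \<mu> ^ p = \<theta>}"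
    by (rule bij_betw_byWitness[where f' = "\<lambda>\<mu>. inverse \<omega> * \<mu>"])
      (use \<omega> in \<open>auto simp: power_mult_distrib power_inverse\<close>)
  then have "(\<Sum>\<mu> | \<mu> ^ p = \<theta>. inverse (\<omega> * \<mu>) ^ r) = (\<Sum>\<mu> | \<mu> ^ p = \<theta>. inverse \<mu> ^ r)"
    by (rule sum.reindex_bij_betw)
  then have "inverse \<omega> ^ r * (\<Sum>\<mu> | \<mu> ^ p = \<theta>. inverse \<mu> ^ r) = (\<Sum>\<mu> | \<mu> ^ p = \<theta>. inverse \<mu> ^ r)"
    by (simp add: sum_distrib_left power_mult_distrib)
  then show ?thesis
    using \<omega>r by simp
qed

text \<open>The \<open>\<mu>\<close>-component of \<open>w\<close> is the discrete Fourier coefficient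
  \<open>p\<inverse> \<Sum>\<^sub>r \<mu>\<^sup>-\<^sup>r T\<^sup>r w\<close>.\<close>

lemma nth_root_eigen_decomposition:
  fixes scale :: "complex \<Rightarrow> 'b::ab_group_add \<Rightarrow> 'b"
  assumes T: "Vector_Spaces.linear scale scale T" and "\<theta> \<noteq> 0" "p > 0"
    and w: "(T ^^ p) w = scale \<theta> w"
    and U: "module.subspace scale U" "w \<in> U" "\<And>v. v \<in> U \<Longrightarrow> T v \<in> U"
  shows "\<exists>u. (\<forall>\<mu>\<in>{\<mu>. \<mu> ^ p = \<theta>}. u \<mu> \<in> U \<and> T (u \<mu>) = scale \<mu> (u \<mu>)) \<and>
    w = (\<Sum>\<mu> | \<mu> ^ p = \<theta>. u \<mu>)"
proof -
  interpret T: Vector_Spaces.linear scale scale T by fact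
  define S where "S \<mu> = (\<Sum>r<p. scale (inverse \<mu> ^ r) ((T ^^ r) w))" for \<mu>
  define u where "u \<mu> = scale (1 / of_nat p) (S \<mu>)" for \<mu>
  have "T (S \<mu>) = scale \<mu> (S \<mu>)" if \<mu>: "\<mu> ^ p = \<theta>" for \<mu>
  proof -
    define g where "g r = scale (inverse \<mu> ^ r) ((T ^^ r) w)" for r
    have "\<mu> \<noteq> 0"
      using \<mu> \<open>\<theta> \<noteq> 0\<close> \<open>p > 0\<close> by auto
    then have step: "T (g r) = scale \<mu> (g (Suc r))" for r
      by (simp add: g_def T.scale)
    \<comment> \<open>Here \<open>T^p w = \<theta> w\<close> cancels
      \<open>\<mu>^(-p) = \<theta>^(-1)\<close>, so the sum over \<open>r\<close> is cyclic and
      \<open>T\<close> only shifts its terms.\<close>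
    have "g p = g 0"
      using \<open>\<theta> \<noteq> 0\<close> by (simp add: g_def w power_inverse \<mu>)
    then have "(\<Sum>r<p. g (Suc r)) = (\<Sum>r<p. g r)"
      using sum.lessThan_Suc_shift[of g p] by simp
    then show ?thesis
      by (simp add: S_def T.sum step flip: g_def T.vs1.scale_sum_right)
  qed
  then have eig: "T (u \<mu>) = scale \<mu> (u \<mu>)" if "\<mu> ^ p = \<theta>" for \<mu>
    using that by (simp add: u_def T.scale T.vs1.scale_left_commute)
  \<comment> \<open>The components are combinations of iterates of \<open>w\<close>, so they stay in
    any invariant subspace containing \<open>w\<close>.\<close>
  have "(T ^^ r) w \<in> U" for r
    by (induction r) (use U in auto)
  then have mem: "u \<mu> \<in> U" for \<mu>
    unfolding u_def S_def using U(1) by (intro T.vs1.subspace_scale T.vs1.subspace_sum)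
  have "(\<Sum>\<mu> | \<mu> ^ p = \<theta>. S \<mu>)
      = (\<Sum>r<p. scale (\<Sum>\<mu> | \<mu> ^ p = \<theta>. inverse \<mu> ^ r) ((T ^^ r) w))"
    unfolding S_def T.vs1.scale_sum_left by (rule sum.swap)
  \<comment> \<open>Only \<open>r = 0\<close> survives, and there the inner sum counts the
    \<open>p\<close> roots.\<close>
  also have "\<dots> = (\<Sum>r<p. if r = 0 then scale (of_nat p) w else 0)"
    using sum_inverse_powers_nth_roots[OF \<open>\<theta> \<noteq> 0\<close>] card_nth_roots[OF \<open>\<theta> \<noteq> 0\<close> \<open>p > 0\<close>]
    by (intro sum.cong) auto
  also have "\<dots> = scale (of_nat p) w"
    using \<open>p > 0\<close> by simp
  finally have "(\<Sum>\<mu> | \<mu> ^ p = \<theta>. u \<mu>) = w"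
    using \<open>p > 0\<close> by (simp add: u_def flip: T.vs1.scale_sum_right)
  then show ?thesis
    using eig mem by (intro exI[of _ u]) auto
qed

section \<open>Quasi-periodic sequences\<close>

definition sscale :: "complex \<Rightarrow> (int \<Rightarrow> 'd::finite cphase) \<Rightarrow> int \<Rightarrow> 'd cphase" where
  "sscale c W = (\<lambda>j. cscale c (W j))"

interpretation cph: vector_space "cscale :: complex \<Rightarrow> 'd::finite cphase \<Rightarrow> _"
  by unfold_locales
    (auto simp: cscale_def vector_add_ldistrib vector_sadd_rdistrib prod_eq_iff)

interpretation seq: vector_space "sscale :: complex \<Rightarrow> (int \<Rightarrow> 'd::finite cphase) \<Rightarrow> _"
  by unfold_locales (auto simp: sscale_def fun_eq_iff algebra_simps)

definition shift :: "nat \<Rightarrow> (int \<Rightarrow> 'a) \<Rightarrow> int \<Rightarrow> 'a" where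
  "shift n W = (\<lambda>j. W (j + int n))"

text \<open>Stated as an eigenspace of the shift, so that the boundary condition becomes a spectral
  one.\<close>

definition quasi_per :: "nat \<Rightarrow> complex \<Rightarrow> (int \<Rightarrow> 'd::finite cphase) set" where
  "quasi_per N \<theta> = {W. shift N W = sscale \<theta> W}"

definition restr :: "nat \<Rightarrow> (int \<Rightarrow> 'd::finite cphase) \<Rightarrow> nat \<Rightarrow> 'd cphase" where
  "restr N W = (\<lambda>i. if i < N then W (int i) else 0)"

lemma shift_funpow: "shift k ^^ p = shift (k * p)"
  by (induction p) (auto simp: shift_def fun_eq_iff algebra_simps)

lemma linear_shift: "Vector_Spaces.linear sscale sscale (shift n)"
  by (auto simp: Vector_Spaces.linear_iff seq.vector_space_axioms shift_def sscale_def)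

lemma linear_restr: "Vector_Spaces.linear sscale tscale (restr N)"
  by (auto simp: Vector_Spaces.linear_iff seq.vector_space_axioms ctup.vector_space_axioms restr_def sscale_def
      tscale_def fun_eq_iff)

lemma linear_quasi_ext: "Vector_Spaces.linear tscale sscale (quasi_ext N \<theta>)"
  by (auto simp: Vector_Spaces.linear_iff seq.vector_space_axioms ctup.vector_space_axioms quasi_ext_def
      sscale_def tscale_def fun_eq_iff cph.scale_right_distrib mult.commute)

lemma subspace_quasi_per: "seq.subspace (quasi_per N \<theta>)"
  by (auto simp: seq.subspace_def quasi_per_def shift_def sscale_def fun_eq_iff
      cph.scale_right_distrib mult.commute)

lemma quasi_ext_in_quasi_per:
  assumes "N > 0" "\<theta> \<noteq> 0"
  shows "quasi_ext N \<theta> Z \<in> quasi_per N \<theta>"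
  using assms
  by (auto simp: quasi_per_def shift_def sscale_def quasi_ext_def fun_eq_iff power_int_add mult.commute)

lemma restr_quasi_ext:
  assumes "Z \<in> ctuples N"
  shows "restr N (quasi_ext N \<theta> Z) = Z"
  using assms by (auto simp: restr_def quasi_ext_def ctuples_def fun_eq_iff)

text \<open>Induction in both directions from 0; negative powers make sense because
  \<open>\<theta>\<close> is nonzero.\<close>

lemma quasi_per_add_mult:
  assumes W: "W \<in> quasi_per N \<theta>" and "\<theta> \<noteq> 0"
  shows "W (j + m * int N) = cscale (\<theta> powi m) (W j)"
proof -
  have step: "W (i + int N) = cscale \<theta> (W i)" for i
    using W by (auto simp: quasi_per_def shift_def sscale_def dest: fun_cong)
  show ?thesis
  proof (induction m rule: int_induct[where k = 0])
    case base
    then show ?case by simp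
  next
    case (step1 i)
    have "W (j + (i + 1) * int N) = W ((j + i * int N) + int N)"
      by (simp add: algebra_simps)
    also have "\<dots> = cscale (\<theta> powi (i + 1)) (W j)"
      using step step1 \<open>\<theta> \<noteq> 0\<close> by (simp add: power_int_add mult.commute)
    finally show ?case .
  next
    case (step2 i)
    \<comment> \<open>Downwards, both sides are compared after multiplication by
      \<open>\<theta>\<close>, which is then cancelled.\<close>
    have "cscale \<theta> (W (j + (i - 1) * int N)) = W ((j + (i - 1) * int N) + int N)"
      by (simp add: step)
    also have "\<dots> = W (j + i * int N)"
      by (simp add: algebra_simps)
    also have "\<dots> = cscale \<theta> (cscale (\<theta> powi (i - 1)) (W j))"
      using step2 \<open>\<theta> \<noteq> 0\<close> by (simp add: power_int_diff)
    finally show ?case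
      unfolding cph.scale_cancel_left using \<open>\<theta> \<noteq> 0\<close> by blast
  qed
qed

text \<open>Division with remainder by \<open>N\<close> reduces every index to the fundamental
  block. With \<open>restr_quasi_ext\<close> this identifies tuples with quasi-periodic
  sequences.\<close>

lemma quasi_ext_restr:
  assumes "W \<in> quasi_per N \<theta>" "N > 0" "\<theta> \<noteq> 0"
  shows "quasi_ext N \<theta> (restr N W) = W"
proof
  fix j
  have "nat (j mod int N) < N"
    using \<open>N > 0\<close> by (simp add: nat_less_iff)
  then have "quasi_ext N \<theta> (restr N W) j = cscale (\<theta> powi (j div int N)) (W (j mod int N))"
    using \<open>N > 0\<close> by (simp add: quasi_ext_def restr_def)
  also have "\<dots> = W (j mod int N + (j div int N) * int N)"
    by (rule quasi_per_add_mult[symmetric]) fact+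
  finally show "quasi_ext N \<theta> (restr N W) j = W j"
    by simp
qed

lemma inj_on_restr:
  assumes "N > 0" "\<theta> \<noteq> 0"
  shows "inj_on (restr N) (quasi_per N \<theta>)"
  using quasi_ext_restr assms by (metis inj_onI)

section \<open>Finite spanning sets\<close>

lemma sum_apply:
  fixes g :: "'a \<Rightarrow> 'b \<Rightarrow> 'c::comm_monoid_add"
  shows "(\<Sum>i\<in>A. g i) x = (\<Sum>i\<in>A. g i x)"
  by (induction A rule: infinite_finite_induct) auto

text \<open>The ambient function space is infinite-dimensional, so finiteness of dimension is
  recorded by a spanning set: the standard vectors of the phase space placed in one of the
  \<open>N\<close> slots.\<close>

lemma ctuples_finite_span:
  "\<exists>F. finite F \<and> (ctuples N :: (nat \<Rightarrow> 'd::finite cphase) set) \<subseteq> ctup.span F"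
proof -
  define e :: "nat \<Rightarrow> 'd cphase \<Rightarrow> nat \<Rightarrow> 'd cphase" where "e i b = (\<lambda>j. if j = i then b else 0)" for i b
  define bas :: "'d cphase set" where "bas = range (\<lambda>a. (axis a 1, 0)) \<union> range (\<lambda>a. (0, axis a 1))"
  define F where "F = (\<lambda>(i, b). e i b) ` ({..<N} \<times> bas)"
  have "Z \<in> ctup.span F" if "Z \<in> ctuples N" for Z
  proof -
    define g where "g i = (\<Sum>a\<in>UNIV. tscale (fst (Z i) $ a) (e i (axis a 1, 0))
        + tscale (snd (Z i) $ a) (e i (0, axis a 1)))" for i
    have "g i j = (if j = i then Z i else 0)" for i j
      by (cases "j = i")
        (simp_all add: g_def sum_apply tscale_def e_def cscale_def sum_prod basis_expansion zero_prod_def)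
    then have "Z = (\<Sum>i<N. g i)"
      using that by (auto simp: fun_eq_iff sum_apply ctuples_def)
    also have "\<dots> \<in> ctup.span F"
      unfolding g_def
      by (intro ctup.span_sum ctup.span_add ctup.span_scale ctup.span_base)
        (auto simp: F_def bas_def)
    finally show ?thesis .
  qed
  moreover have "finite F"
    by (simp add: F_def bas_def)
  ultimately show ?thesis by blast
qed

lemma quasi_per_finite_span:
  assumes "N > 0" "\<theta> \<noteq> 0"
  shows "\<exists>F. finite F \<and> (quasi_per N \<theta> :: (int \<Rightarrow> 'd::finite cphase) set) \<subseteq> seq.span F"
proof -
  interpret q: Vector_Spaces.linear tscale sscale "quasi_ext N \<theta> :: (nat \<Rightarrow> 'd cphase) \<Rightarrow> _"
    by (rule linear_quasi_ext)
  obtain F :: "(nat \<Rightarrow> 'd cphase) set" where F: "finite F" "ctuples N \<subseteq> ctup.span F"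
    using ctuples_finite_span by blast
  have "W \<in> quasi_ext N \<theta> ` ctuples N" if "W \<in> quasi_per N \<theta>" for W :: "int \<Rightarrow> 'd cphase"
  proof -
    have "restr N W \<in> ctuples N"
      by (simp add: ctuples_def restr_def)
    then show ?thesis
      using quasi_ext_restr[OF that assms] by (metis imageI)
  qed
  then have "quasi_per N \<theta> \<subseteq> seq.span (quasi_ext N \<theta> ` F)"
    using q.spans_image[OF F(2)] by blast
  then show ?thesis
    using F(1) by blast
qed

section \<open>The Hessian as an operator on sequences\<close>

text \<open>The formula of \<open>theta_hessian\<close> without \<open>p\<close> and
  \<open>\<theta>\<close>, which now enter only through the space acted on.\<close>

definition seq_hessian ::
  "(nat \<Rightarrow> 'd::finite phase \<Rightarrow> real) \<Rightarrow> nat \<Rightarrow> (nat \<Rightarrow> 'd phase) \<Rightarrow> (int \<Rightarrow> 'd cphase) \<Rightarrow> int \<Rightarrow> 'd cphase" where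
  "seq_hessian f k z W = (\<lambda>j.
     (snd (W (j - 1)) - snd (W j) + complexify (matA f k z (j - 1)) *v fst (W j)
        + transpose (complexify (matB f k z (j - 1))) *v snd (W (j - 1)),
      fst (W (j + 1)) - fst (W j) + complexify (matB f k z j) *v fst (W (j + 1))
        + complexify (matC f k z j) *v snd (W j)))"

text \<open>A simultaneous eigenspace of two commuting operators, the shift by \<open>k * p\<close>
  and the difference operator.\<close>

definition seq_eigenspace ::
  "(nat \<Rightarrow> 'd::finite phase \<Rightarrow> real) \<Rightarrow> nat \<Rightarrow> (nat \<Rightarrow> 'd phase) \<Rightarrow> nat \<Rightarrow> complex \<Rightarrow> complex \<Rightarrow>
   (int \<Rightarrow> 'd cphase) set" where
  "seq_eigenspace f k z p \<theta> c = {W \<in> quasi_per (k * p) \<theta>. seq_hessian f k z W = sscale c W}"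

lemma linear_seq_hessian: "Vector_Spaces.linear sscale sscale (seq_hessian f k z)"
  unfolding Vector_Spaces.linear_iff
  by (auto simp: seq.vector_space_axioms seq_hessian_def sscale_def cscale_def fun_eq_iff
      matrix_vector_right_distrib vector_scalar_commute vector_add_ldistrib vector_ssub_ldistrib)

lemma seq_hessian_shift: "seq_hessian f k z (shift k W) = shift k (seq_hessian f k z W)"
proof -
  have "matA f k z (j + int k) = matA f k z j" "matB f k z (j + int k) = matB f k z j"
    "matC f k z (j + int k) = matC f k z j" for j
    using mod_add_self2[of "j + 1" "int k"]
    by (simp_all add: matA_def matB_def matC_def mixed_pt_def add_ac)
  \<comment> \<open>The operator also reads \<open>A\<close> and \<open>B\<close> at
    \<open>j - 1\<close>, so periodicity is instantiated there too.\<close>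
  from this[of "_ - 1"] this show ?thesis
    by (simp add: seq_hessian_def shift_def fun_eq_iff algebra_simps)
qed

lemma seq_hessian_shift_mult:
  "seq_hessian f k z (shift (k * p) W) = shift (k * p) (seq_hessian f k z W)"
  unfolding shift_funpow[symmetric] by (induction p) (auto simp: seq_hessian_shift)

lemma seq_hessian_in_quasi_per:
  assumes "W \<in> quasi_per (k * p) \<theta>"
  shows "seq_hessian f k z W \<in> quasi_per (k * p) \<theta>"
proof -
  interpret Vector_Spaces.linear sscale sscale "seq_hessian f k z"
    by (rule linear_seq_hessian)
  show ?thesis
    using assms by (simp add: quasi_per_def scale flip: seq_hessian_shift_mult)
qed

lemma theta_hessian_eq_restr:
  "theta_hessian f k z p \<theta> Z = restr (k * p) (seq_hessian f k z (quasi_ext (k * p) \<theta> Z))"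
  by (auto simp: theta_hessian_def restr_def seq_hessian_def Let_def fun_eq_iff)

section \<open>Comparison of eigenspaces of tuples and of sequences\<close>

text \<open>Both sides of the eigenvalue equation are quasi-periodic, so by injectivity of
  \<open>restr\<close> its validity on the first \<open>k * p\<close> entries extends to all
  integers.\<close>

lemma theta_eigenspace_eq_image:
  assumes "k * p > 0" "\<theta> \<noteq> 0"
  shows "theta_eigenspace f k z p \<theta> \<nu> = restr (k * p) ` seq_eigenspace f k z p \<theta> (complex_of_real \<nu>)"
proof -
  interpret r: Vector_Spaces.linear sscale tscale "restr (k * p) :: (int \<Rightarrow> 'a cphase) \<Rightarrow> _"
    by (rule linear_restr)
  have *: "theta_hessian f k z p \<theta> (restr (k * p) W) = tscale c (restr (k * p) W)
      \<longleftrightarrow> seq_hessian f k z W = sscale c W"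
    if "W \<in> quasi_per (k * p) \<theta>" for W c
  proof -
    have "sscale c W \<in> quasi_per (k * p) \<theta>"
      using that subspace_quasi_per seq.subspace_scale by blast
    then have "restr (k * p) (seq_hessian f k z W) = restr (k * p) (sscale c W)
        \<longleftrightarrow> seq_hessian f k z W = sscale c W"
      by (rule inj_on_eq_iff[OF inj_on_restr[OF assms] seq_hessian_in_quasi_per[OF that]])
    then show ?thesis
      by (simp add: theta_hessian_eq_restr quasi_ext_restr[OF that assms] r.scale)
  qed
  show ?thesis
  proof (intro equalityI subsetI)
    fix Z assume Z: "Z \<in> theta_eigenspace f k z p \<theta> \<nu>"
    let ?W = "quasi_ext (k * p) \<theta> Z"
    have "?W \<in> quasi_per (k * p) \<theta>"
      using assms by (rule quasi_ext_in_quasi_per)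
    moreover have "Z = restr (k * p) ?W"
      using Z by (simp add: theta_eigenspace_def restr_quasi_ext)
    ultimately show "Z \<in> restr (k * p) ` seq_eigenspace f k z p \<theta> (complex_of_real \<nu>)"
      using Z *[of ?W] by (auto simp: theta_eigenspace_def seq_eigenspace_def image_iff)
  next
    fix Z assume "Z \<in> restr (k * p) ` seq_eigenspace f k z p \<theta> (complex_of_real \<nu>)"
    then show "Z \<in> theta_eigenspace f k z p \<theta> \<nu>"
      using * by (auto simp: theta_eigenspace_def seq_eigenspace_def ctuples_def restr_def)
  qed
qed

lemma subspace_seq_eigenspace: "seq.subspace (seq_eigenspace f k z p \<theta> c)"
proof -
  interpret Vector_Spaces.linear sscale sscale "seq_hessian f k z"
    by (rule linear_seq_hessian)
  have "seq.subspace {W. seq_hessian f k z W = sscale c W}"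
    by (auto simp: seq.subspace_def add scale seq.scale_right_distrib seq.scale_left_commute)
  moreover have "seq_eigenspace f k z p \<theta> c
      = quasi_per (k * p) \<theta> \<inter> {W. seq_hessian f k z W = sscale c W}"
    by (auto simp: seq_eigenspace_def)
  ultimately show ?thesis
    using seq.subspace_inter[OF subspace_quasi_per] by simp
qed

lemma dim_theta_eigenspace_eq:
  assumes "k * p > 0" "\<theta> \<noteq> 0"
  shows "ctup.dim (theta_eigenspace f k z p \<theta> \<nu>) = seq.dim (seq_eigenspace f k z p \<theta> (complex_of_real \<nu>))"
proof -
  interpret vector_space_pair "sscale :: complex \<Rightarrow> (int \<Rightarrow> 'a cphase) \<Rightarrow> _" tscale ..
  have "seq.span (seq_eigenspace f k z p \<theta> (complex_of_real \<nu>)) \<subseteq> quasi_per (k * p) \<theta>"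
    by (rule seq.span_minimal[OF _ subspace_quasi_per]) (auto simp: seq_eigenspace_def)
  then have "inj_on (restr (k * p)) (seq.span (seq_eigenspace f k z p \<theta> (complex_of_real \<nu>)))"
    by (rule inj_on_subset[OF inj_on_restr[OF assms]])
  then show ?thesis
    by (simp add: theta_eigenspace_eq_image[OF assms] dim_image_eq_inj[OF linear_restr])
qed

section \<open>Splitting of eigenspaces over the roots\<close>

text \<open>The linear algebra is applied to the shift by \<open>k\<close>, with the roots
  \<open>\<mu>\<close> as its eigenvalues; the Hessian eigenvalue \<open>c\<close> stays fixed
  throughout.\<close>

lemma dim_seq_eigenspace:
  assumes "k \<ge> 1" "p \<ge> 1" "\<theta> \<noteq> 0"
  shows "seq.dim (seq_eigenspace f k z p \<theta> c) = (\<Sum>\<mu> | \<mu> ^ p = \<theta>. seq.dim (seq_eigenspace f k z 1 \<mu> c))"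
proof -
  interpret L: Vector_Spaces.linear sscale sscale "seq_hessian f k z"
    by (rule linear_seq_hessian)
  interpret S: Vector_Spaces.linear sscale sscale "shift k :: (int \<Rightarrow> 'a cphase) \<Rightarrow> _"
    by (rule linear_shift)
  \<comment> \<open>\<open>U\<close> is shift-invariant, so the Fourier components of an eigenvector
    remain eigenvectors of the difference operator for \<open>c\<close>.\<close>
  define U where "U = {W. seq_hessian f k z W = sscale c W}"
  have U: "seq.subspace U"
    by (auto simp: U_def seq.subspace_def L.add L.scale seq.scale_right_distrib seq.scale_left_commute)
  have U_shift: "shift k W \<in> U" if "W \<in> U" for W
    using that by (simp add: U_def seq_hessian_shift S.scale)
  \<comment> \<open>All orders and multipliers become conditions on powers of one shift within the
    same \<open>U\<close>.\<close>
  have E: "seq_eigenspace f k z q \<mu> c = {W \<in> U. (shift k ^^ q) W = sscale \<mu> W}" for q \<mu>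
    by (auto simp: seq_eigenspace_def quasi_per_def U_def shift_funpow)
  obtain F :: "(int \<Rightarrow> 'a cphase) set" where F: "finite F" "quasi_per (k * p) \<theta> \<subseteq> seq.span F"
    using quasi_per_finite_span[of "k * p" \<theta>] assms by auto
  show ?thesis
  proof (rule seq.dim_sum_eigenspaces[OF linear_shift])
    show "finite {\<mu>. \<mu> ^ p = \<theta>}"
      using assms by (intro finite_nth_roots) auto
    show "finite F" by fact
    show "seq_eigenspace f k z p \<theta> c \<subseteq> seq.span F"
      using F(2) by (auto simp: seq_eigenspace_def)
  next
    fix \<mu> W assume "\<mu> \<in> {\<mu>. \<mu> ^ p = \<theta>}" and W: "W \<in> seq_eigenspace f k z 1 \<mu> c"
    have "(shift k ^^ q) W = sscale (\<mu> ^ q) W" for q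
      by (induction q) (use W in \<open>auto simp: E S.scale mult.commute\<close>)
    then show "W \<in> seq_eigenspace f k z p \<theta> c \<and> shift k W = sscale \<mu> W"
      using W \<open>\<mu> \<in> _\<close> by (auto simp: E)
  next
    fix W assume "W \<in> seq_eigenspace f k z p \<theta> c"
    then show "\<exists>u. (\<forall>\<mu>\<in>{\<mu>. \<mu> ^ p = \<theta>}. u \<mu> \<in> seq_eigenspace f k z 1 \<mu> c) \<and> W = sum u {\<mu>. \<mu> ^ p = \<theta>}"
      using nth_root_eigen_decomposition[OF linear_shift, of \<theta> p k W U] U U_shift assms
      by (auto simp: E)
  qed
qed

section \<open>Summation over the eigenvalues\<close>

text \<open>A sum over an infinite set has the default value 0, so finiteness is what gives the sums
  in \<open>bott_ind\<close> and \<open>bott_coind\<close> their meaning. It follows from finite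
  dimension, real eigenvalues embedding injectively into the complex ones.\<close>

lemma finite_theta_eigenvalues:
  assumes "k * p > 0" "\<theta> \<noteq> 0"
  shows "finite (theta_eigenvalues f k z p \<theta>)"
proof -
  interpret r: Vector_Spaces.linear sscale tscale "restr (k * p) :: (int \<Rightarrow> 'a cphase) \<Rightarrow> _"
    by (rule linear_restr)
  obtain F :: "(int \<Rightarrow> 'a cphase) set" where F: "finite F" "quasi_per (k * p) \<theta> \<subseteq> seq.span F"
    using quasi_per_finite_span[OF assms] by auto
  let ?I = "{c. \<exists>W\<in>quasi_per (k * p) \<theta>. W \<noteq> 0 \<and> seq_hessian f k z W = sscale c W}"
  have "complex_of_real \<nu> \<in> ?I" if \<nu>: "\<nu> \<in> theta_eigenvalues f k z p \<theta>" for \<nu>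
  proof -
    obtain Z where "Z \<in> theta_eigenspace f k z p \<theta> \<nu>" "Z \<noteq> 0"
      using \<nu> by (auto simp: theta_eigenvalues_def)
    then obtain W where W: "W \<in> seq_eigenspace f k z p \<theta> (complex_of_real \<nu>)" "restr (k * p) W \<noteq> 0"
      unfolding theta_eigenspace_eq_image[OF assms] by blast
    then have "W \<noteq> 0"
      using r.zero by auto
    then show ?thesis
      using W(1) by (auto simp: seq_eigenspace_def)
  qed
  then have "complex_of_real ` theta_eigenvalues f k z p \<theta> \<subseteq> ?I"
    by blast
  then have "finite (complex_of_real ` theta_eigenvalues f k z p \<theta>)"
    using seq.finite_eigenvalues[OF linear_seq_hessian F] by (rule finite_subset)
  then show ?thesis
    by (rule finite_imageD) (rule inj_onI, simp)
qed

text \<open>Allows sums over eigenvalues to be enlarged by zero terms.\<close>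

lemma dim_theta_eigenspace_eq_0:
  assumes "\<nu> \<notin> theta_eigenvalues f k z p \<theta>"
  shows "ctup.dim (theta_eigenspace f k z p \<theta> \<nu>) = 0"
proof -
  have "theta_eigenspace f k z p \<theta> \<nu> \<subseteq> ctup.span {}"
    using assms by (auto simp: theta_eigenvalues_def)
  then show ?thesis
    using ctup.dim_le_card[of _ "{}"] by simp
qed

lemma dim_theta_eigenspace:
  assumes "k \<ge> 1" "p \<ge> 1" "\<theta> \<noteq> 0"
  shows "ctup.dim (theta_eigenspace f k z p \<theta> \<nu>)
    = (\<Sum>\<mu> | \<mu> ^ p = \<theta>. ctup.dim (theta_eigenspace f k z 1 \<mu> \<nu>))"
proof -
  have "seq.dim (seq_eigenspace f k z 1 \<mu> (complex_of_real \<nu>)) = ctup.dim (theta_eigenspace f k z 1 \<mu> \<nu>)"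
    if "\<mu> ^ p = \<theta>" for \<mu>
    by (rule dim_theta_eigenspace_eq[symmetric]) (use that assms in auto)
  moreover have "ctup.dim (theta_eigenspace f k z p \<theta> \<nu>)
      = seq.dim (seq_eigenspace f k z p \<theta> (complex_of_real \<nu>))"
    by (rule dim_theta_eigenspace_eq) (use assms in auto)
  ultimately show ?thesis
    unfolding dim_seq_eigenspace[OF assms] by simp
qed

text \<open>\<open>P\<close> stands for a sign condition, so that one argument serves both index and
  coindex.\<close>

lemma sum_dim_theta_eigenspace:
  assumes "k \<ge> 1" "p \<ge> 1" "\<theta> \<noteq> 0"
  shows "(\<Sum>\<nu> \<in> {\<nu> \<in> theta_eigenvalues f k z p \<theta>. P \<nu>}. ctup.dim (theta_eigenspace f k z p \<theta> \<nu>))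
    = (\<Sum>\<mu> | \<mu> ^ p = \<theta>. \<Sum>\<nu> \<in> {\<nu> \<in> theta_eigenvalues f k z 1 \<mu>. P \<nu>}.
        ctup.dim (theta_eigenspace f k z 1 \<mu> \<nu>))"
proof -
  \<comment> \<open>A common finite range for \<open>\<nu>\<close>, independent of
    \<open>\<mu>\<close>, so that the two summations can be exchanged.\<close>
  define \<Lambda> where "\<Lambda> = theta_eigenvalues f k z p \<theta> \<union> (\<Union>\<mu>\<in>{\<mu>. \<mu> ^ p = \<theta>}. theta_eigenvalues f k z 1 \<mu>)"
  have nz: "\<mu> \<noteq> 0" if "\<mu> ^ p = \<theta>" for \<mu>
    using that assms by auto
  have fin: "finite \<Lambda>"
    unfolding \<Lambda>_def using assms nz by (auto intro!: finite_theta_eigenvalues finite_nth_roots)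
  have ext: "(\<Sum>\<nu> \<in> {\<nu> \<in> theta_eigenvalues f k z q \<mu>. P \<nu>}. ctup.dim (theta_eigenspace f k z q \<mu> \<nu>))
      = (\<Sum>\<nu> \<in> {\<nu> \<in> \<Lambda>. P \<nu>}. ctup.dim (theta_eigenspace f k z q \<mu> \<nu>))"
    if "theta_eigenvalues f k z q \<mu> \<subseteq> \<Lambda>" for q \<mu>
  proof (rule sum.mono_neutral_left)
    show "\<forall>\<nu>\<in>{\<nu> \<in> \<Lambda>. P \<nu>} - {\<nu> \<in> theta_eigenvalues f k z q \<mu>. P \<nu>}.
        ctup.dim (theta_eigenspace f k z q \<mu> \<nu>) = 0"
      using dim_theta_eigenspace_eq_0 by blast
  qed (use fin that in auto)
  have "(\<Sum>\<nu> \<in> {\<nu> \<in> theta_eigenvalues f k z p \<theta>. P \<nu>}. ctup.dim (theta_eigenspace f k z p \<theta> \<nu>))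
      = (\<Sum>\<nu> \<in> {\<nu> \<in> \<Lambda>. P \<nu>}. \<Sum>\<mu> | \<mu> ^ p = \<theta>. ctup.dim (theta_eigenspace f k z 1 \<mu> \<nu>))"
    by (subst ext) (auto simp: \<Lambda>_def dim_theta_eigenspace[OF assms])
  also have "\<dots> = (\<Sum>\<mu> | \<mu> ^ p = \<theta>. \<Sum>\<nu> \<in> {\<nu> \<in> \<Lambda>. P \<nu>}. ctup.dim (theta_eigenspace f k z 1 \<mu> \<nu>))"
    by (rule sum.swap)
  also have "\<dots> = (\<Sum>\<mu> | \<mu> ^ p = \<theta>. \<Sum>\<nu> \<in> {\<nu> \<in> theta_eigenvalues f k z 1 \<mu>. P \<nu>}.
        ctup.dim (theta_eigenspace f k z 1 \<mu> \<nu>))"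
    by (rule sum.cong[OF refl], subst ext) (auto simp: \<Lambda>_def)
  finally show ?thesis .
qed

lemma bott_nul_eq_dim: "bott_nul f k z p \<theta> = ctup.dim (theta_eigenspace f k z p \<theta> 0)"
  by (simp add: bott_nul_def theta_eigenspace_def)

theorem lemma2p2:
  fixes \<phi> :: "nat \<Rightarrow> 'd::finite phase \<Rightarrow> 'd phase"
    and f :: "nat \<Rightarrow> 'd phase \<Rightarrow> real"
    and z :: "nat \<Rightarrow> 'd phase"
    and z0 :: "'d phase"
    and k p :: nat
    and \<epsilon> :: real
    and \<theta> :: complex
  assumes "k \<ge> 1"
    and "\<And>j. j < k \<Longrightarrow> hamiltonian_diffeo (\<phi> j)"
    and "\<And>j. j < k \<Longrightarrow> generating_function (f j) (\<phi> j)"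
    and "comp_upto \<phi> k z0 = z0"
    and "z 0 = z0"
    and "\<And>j. 1 \<le> j \<Longrightarrow> j < k \<Longrightarrow> z j = \<phi> (j - 1) (z (j - 1))"
    and "\<epsilon> < 1"
    and "\<And>j. onorm ((*v) (matA f k z j)) \<le> \<epsilon>"
    and "\<And>j. onorm ((*v) (matB f k z j)) \<le> \<epsilon>"
    and "\<And>j. onorm ((*v) (matC f k z j)) \<le> \<epsilon>"
    and "p \<ge> 1"
    and "cmod \<theta> = 1"
  shows "bott_nul f k z p \<theta> = (\<Sum>\<mu> | \<mu> ^ p = \<theta>. bott_nul f k z 1 \<mu>) \<and>
    bott_ind f k z p \<theta> = (\<Sum>\<mu> | \<mu> ^ p = \<theta>. bott_ind f k z 1 \<mu>) \<and>
    bott_coind f k z p \<theta> = (\<Sum>\<mu> | \<mu> ^ p = \<theta>. bott_coind f k z 1 \<mu>)"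
proof -
  have "\<theta> \<noteq> 0"
    using \<open>cmod \<theta> = 1\<close> by auto
  note * = \<open>k \<ge> 1\<close> \<open>p \<ge> 1\<close> this
  show ?thesis
    \<comment> \<open>The nullity is the single eigenvalue 0; the other two formulae sum over one
      sign.\<close>
    unfolding bott_nul_eq_dim bott_ind_def bott_coind_def
    using dim_theta_eigenspace[OF *, of f z 0] sum_dim_theta_eigenspace[OF *, of f z "\<lambda>\<nu>. \<nu> < 0"]
      sum_dim_theta_eigenspace[OF *, of f z "\<lambda>\<nu>. \<nu> > 0"]
    by (intro conjI)
qed

end
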